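(* Let $m$ and $r$ be arbitrary integers and define \[ n = \big((4m^2 - 4m + 2)r^2 - (8m^3 - 8m^2 + 2)r + 4m(m + 1)(m - 1)^2\big)^2 . \] Then each of the four integers $n$, $n+1$, $n+2$, $n+4$ can be written as a sum of two squares of integers. Further, if $m$ and $r$ are both multiples of $5$, then each of these four integers can be written as $a^2+b^2$ with $a,b$ nonzero integers.
   Formalization: In the second claim the case m = r = 0 is excluded, since there n = 0 and 0 (as well as n+1 = 1 and n+4 = 4) is not a sum of two nonzero squares; the first claim is unrestricted. *)

theory Defs
  imports Complex_Main
begin

end

theory Submission
  imports Defs
begin

text \<open>
  Put \<open>q = r - m\<close>, \<open>u = m\<^sup>2 - m\<close> and \<open>t = 2 m - 1\<close>. Then \<open>n = (2 P)\<^sup>2\<close> with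
  \<open>P = (2 u + 1) q\<^sup>2 + t q - u\<close>, and only \<open>n + 2 = 4 P\<^sup>2 + 2\<close> needs work. There is a polynomial
  identity \<open>2 P\<^sup>2 + 1 = c\<^sup>2 + d\<^sup>2\<close>, found by expanding in powers of \<open>q\<close> from the constant term
  \<open>2 u\<^sup>2 + 1 = (m\<^sup>2 - 1)\<^sup>2 + (m\<^sup>2 - 2 m)\<^sup>2\<close>; then \<open>n + 2 = (c + d)\<^sup>2 + (c - d)\<^sup>2\<close>, with both
  summands odd. If 5 divides \<open>m\<close> and \<open>r\<close>, then \<open>2 P = 5 k\<close>, so \<open>n = (3 k)\<^sup>2 + (4 k)\<^sup>2\<close>, and
  \<open>P \<noteq> 0\<close> because its quadratic term dominates when \<open>q \<noteq> 0\<close>.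
\<close>

lemma four_square_plus_two_eq:
  fixes m q :: int
  defines "u \<equiv> m\<^sup>2 - m" and "t \<equiv> 2 * m - 1"
  shows "4 * ((2 * u + 1) * q\<^sup>2 + t * q - u)\<^sup>2 + 2
       = (2 * (u - 2 * u * q\<^sup>2 - t * q) - 1)\<^sup>2 + (2 * (m - q - t * q\<^sup>2) - 1)\<^sup>2"
  unfolding u_def t_def by algebra

text \<open>At \<open>q = 0\<close> the value is \<open>- m * (m - 1)\<close>. Otherwise
  \<open>q\<^sup>2 \<ge> |q| \<ge> 1\<close> bounds it below by \<open>u + 1 - |2 * m - 1|\<close>,
  which is positive exactly for \<open>m\<close> in the assumed range.\<close>

lemma quadratic_form_nonzero:
  fixes m q :: int
  assumes "m \<le> -2 \<or> 3 \<le> m"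
  shows "(2 * (m\<^sup>2 - m) + 1) * q\<^sup>2 + (2 * m - 1) * q - (m\<^sup>2 - m) \<noteq> 0"
proof (cases "q = 0")
  case True
  have "m * (m - 1) \<noteq> 0" using assms by auto
  with True show ?thesis by (simp add: power2_eq_square algebra_simps)
next
  case False
  define u where "u = m\<^sup>2 - m"
  \<comment> \<open>The first product gives \<open>gap\<close> when \<open>m \<ge> 3\<close>, the
    second when \<open>m \<le> -2\<close>.\<close>
  have "0 \<le> (m - 3) * m \<and> 0 \<le> (m + 2) * (m - 1)"
    using assms by (auto simp: zero_le_mult_iff)
  then have gap: "\<bar>2 * m - 1\<bar> < u + 1" and "0 \<le> u"
    using assms by (auto simp: u_def power2_eq_square algebra_simps abs_if)
  have q: "1 \<le> \<bar>q\<bar>" using False by simp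
  have "u + 1 - \<bar>2 * m - 1\<bar> \<le> (2 * u + 1 - \<bar>2 * m - 1\<bar>) * 1 - u" by simp
  also have "\<dots> \<le> (2 * u + 1 - \<bar>2 * m - 1\<bar>) * \<bar>q\<bar> - u"
    using mult_left_mono[OF q, of "2 * u + 1 - \<bar>2 * m - 1\<bar>"] gap \<open>0 \<le> u\<close> by linarith
  also have "\<dots> \<le> (2 * u + 1) * q\<^sup>2 + (2 * m - 1) * q - u"
  proof -
    have "\<bar>q\<bar> * 1 \<le> \<bar>q\<bar> * \<bar>q\<bar>" using q by (intro mult_left_mono) auto
    then have "\<bar>q\<bar> \<le> q\<^sup>2" by (simp add: power2_eq_square)
    then have "(2 * u + 1) * \<bar>q\<bar> \<le> (2 * u + 1) * q\<^sup>2"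
      using \<open>0 \<le> u\<close> by (intro mult_left_mono) auto
    moreover have "- (\<bar>2 * m - 1\<bar> * \<bar>q\<bar>) \<le> (2 * m - 1) * q"
      using abs_ge_minus_self[of "(2 * m - 1) * q"] unfolding abs_mult by linarith
    ultimately show ?thesis by (simp add: left_diff_distrib)
  qed
  finally show ?thesis using gap unfolding u_def by linarith
qed

theorem theorem3p2:
  fixes m r n :: int
  assumes n_def: "n = ((4 * m^2 - 4 * m + 2) * r^2 - (8 * m^3 - 8 * m^2 + 2) * r
                       + 4 * m * (m + 1) * (m - 1)^2)^2"
  shows "(\<forall>k \<in> {n, n + 1, n + 2, n + 4}. \<exists>a b :: int. k = a^2 + b^2)
       \<and> (5 dvd m \<and> 5 dvd r \<and> \<not> (m = 0 \<and> r = 0) \<longrightarrow>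
            (\<forall>k \<in> {n, n + 1, n + 2, n + 4}.
               \<exists>a b :: int. a \<noteq> 0 \<and> b \<noteq> 0 \<and> k = a^2 + b^2))"
proof -
  define P where
    "P = (2 * (m\<^sup>2 - m) + 1) * (r - m)\<^sup>2 + (2 * m - 1) * (r - m) - (m\<^sup>2 - m)"
  have n: "n = (2 * P)\<^sup>2"
    unfolding n_def P_def by algebra
  have two: "\<exists>a b :: int. a \<noteq> 0 \<and> b \<noteq> 0 \<and> n + 2 = a\<^sup>2 + b\<^sup>2"
  proof -
    have odd_nz: "2 * x - 1 \<noteq> 0" for x :: int by presburger
    have "n + 2 = 4 * P\<^sup>2 + 2" by (simp add: n power_mult_distrib)
    also note four_square_plus_two_eq[of m "r - m", folded P_def]
    finally show ?thesis using odd_nz by blast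
  qed
  have "\<exists>a b :: int. n = a\<^sup>2 + b\<^sup>2"
    by (rule exI[of _ "2 * P"], rule exI[of _ 0]) (simp add: n)
  moreover have one: "n + 1 = (2 * P)\<^sup>2 + 1\<^sup>2" and four: "n + 4 = (2 * P)\<^sup>2 + 2\<^sup>2"
    by (simp_all add: n)
  ultimately have "\<forall>k \<in> {n, n + 1, n + 2, n + 4}. \<exists>a b :: int. k = a\<^sup>2 + b\<^sup>2"
    using two by blast
  \<comment> \<open>The case \<open>m = r = 0\<close> is excluded because there
    \<open>n = 0\<close>, which is no sum of two nonzero squares.\<close>
  moreover have "\<forall>k \<in> {n, n + 1, n + 2, n + 4}. \<exists>a b :: int. a \<noteq> 0 \<and> b \<noteq> 0 \<and> k = a\<^sup>2 + b\<^sup>2"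
    if "5 dvd m" "5 dvd r" "\<not> (m = 0 \<and> r = 0)"
  proof -
    have "P \<noteq> 0"
    proof (cases "m = 0")
      case True
      \<comment> \<open>Divisibility by 5 rules out the root \<open>r = 1\<close>.\<close>
      then have "r \<noteq> 0" "r \<noteq> 1" using that by auto
      moreover have "P = r * (r - 1)" using True by (simp add: P_def power2_eq_square algebra_simps)
      ultimately show ?thesis by simp
    next
      case False
      then have "m \<le> -2 \<or> 3 \<le> m" using \<open>5 dvd m\<close> by presburger
      then show ?thesis unfolding P_def by (rule quadratic_form_nonzero)
    qed
    moreover have "5 dvd P"
    proof -
      have "5 dvd r - m" "5 dvd m\<^sup>2 - m" using that by (simp_all add: power2_eq_square)
      then show ?thesis unfolding P_def by (simp add: power2_eq_square)
    qed
    then obtain k where "P = 5 * k" ..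
    \<comment> \<open>Here \<open>2 * P = 10 * k\<close>, and 6, 8, 10 is a Pythagorean
      triple.\<close>
    ultimately have "k \<noteq> 0" and "n = (6 * k)\<^sup>2 + (8 * k)\<^sup>2"
      by (auto simp: n power_mult_distrib)
    then have "\<exists>a b :: int. a \<noteq> 0 \<and> b \<noteq> 0 \<and> n = a\<^sup>2 + b\<^sup>2"
      by (intro exI[of _ "6 * k"] exI[of _ "8 * k"]) simp
    moreover have "2 * P \<noteq> 0" "(1::int) \<noteq> 0" "(2::int) \<noteq> 0" using \<open>P \<noteq> 0\<close> by simp_all
    ultimately show ?thesis using one two four by blast
  qed
  ultimately show ?thesis by blast
qed

end
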